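(* Let $I=[x_0,x_N]$ be a compact interval with partition $\Delta: x_0<x_1<\dots<x_N$, $N\ge 2$, and let $\alpha=(\alpha_1,\dots,\alpha_N)$ be a scale vector, i.e. $|\alpha_i|<1$ for all $i$. Let $f^\alpha$ be the $\alpha$-fractal function of $f\in\mathcal C(I)$ with base function $b\in\mathcal C(I)$ (so $b(x_0)=f(x_0)$, $b(x_N)=f(x_N)$) and partition $\Delta$. Let $f_F^{\alpha_F}$ be the $\alpha_F$-fractal function of $f_F$ on $I_F=[-x_N,-x_0]$ with base function $b_F$ and partition $\Delta_F:-x_N<-x_{N-1}<\dots<-x_0$, where $f_F(x)=f(-x)$ and $b_F(x)=b(-x)$ for $x\in I_F$ and $\alpha_F=(\alpha_N,\alpha_{N-1},\dots,\alpha_1)$. Then $f_F^{\alpha_F}$ is the flipped function of $f^\alpha$ about the $y$-axis, i.e. $$f_F^{\alpha_F}(-x)=f^\alpha(x)\quad\text{for all }x\in I.$$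
   Context: $\mathcal C(J)$ is the space of continuous real-valued functions on a compact interval $J$. Let $N\ge2$, let $\Delta:x_0<x_1<\dots<x_N$ be a partition of $I=[x_0,x_N]$, and set $I_i=[x_{i-1},x_i]$ for $i=1,\dots,N$. Let $L_i:I\to I_i$, $L_i(x)=a_ix+e_i$, with $a_i=\frac{x_i-x_{i-1}}{x_N-x_0}$ and $e_i=\frac{x_Nx_{i-1}-x_0x_i}{x_N-x_0}$, so $L_i(x_0)=x_{i-1}$ and $L_i(x_N)=x_i$. A scale vector is $\alpha=(\alpha_1,\dots,\alpha_N)\in\mathbb R^N$ with $|\alpha_i|<1$ for all $i$. A base function for $f\in\mathcal C(I)$ is a function $b\in\mathcal C(I)$ with $b(x_0)=f(x_0)$ and $b(x_N)=f(x_N)$. The $\alpha$-fractal function $f^\alpha$ of $f$ with base function $b$ and partition $\Delta$ is the continuous function on $I$ whose graph is the attractor of the iterated function system $W_i(x,y)=(L_i(x),\ \alpha_i y+f(L_i(x))-\alpha_i b(x))$, $i=1,\dots,N$, on $I\times\mathbb R$; equivalently, it is the unique function in $\mathcal C(I)$ satisfying $f^\alpha(x)=f(x)+\alpha_i\,(f^\alpha-b)(L_i^{-1}(x))$ for all $x\in I_i$, $i=1,\dots,N$. On the flipped side, put $I_{Fi}=[-x_{N+1-i},-x_{N-i}]$ and $L_{Fi}:I_F\to I_{Fi}$, $L_{Fi}(x)=a_{N+1-i}x-e_{N+1-i}$, $i=1,\dots,N$. Then $f_F^{\alpha_F}$ is the unique function in $\mathcal C(I_F)$ satisfying $f_F^{\alpha_F}(x)=f_F(x)+\alpha_{N+1-i}\,(f_F^{\alpha_F}-b_F)(L_{Fi}^{-1}(x))$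 for all $x\in I_{Fi}$, $i=1,\dots,N$. *)

theory Defs
  imports "HOL-Analysis.Analysis"
begin

text \<open>
  The attractor of an iterated function system \<open>(W i)\<close>, \<open>i \<in> S\<close>, on \<open>X\<close> is the unique nonempty
  compact subset of \<open>X\<close> that is a fixed point of the Hutchinson operator.
\<close>

definition ifs_invariant :: "'a::topological_space set \<Rightarrow> 'i set \<Rightarrow> ('i \<Rightarrow> 'a \<Rightarrow> 'a) \<Rightarrow> 'a set \<Rightarrow> bool" where
  "ifs_invariant X S W A \<longleftrightarrow>
     A \<subseteq> X \<and> A \<noteq> {} \<and> compact A \<and> A = (\<Union>i\<in>S. W i ` A)"

definition ifs_attractor :: "'a::topological_space set \<Rightarrow> 'i set \<Rightarrow> ('i \<Rightarrow> 'a \<Rightarrow> 'a) \<Rightarrow> 'a set \<Rightarrow> bool" where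
  "ifs_attractor X S W A \<longleftrightarrow>
     ifs_invariant X S W A \<and> (\<forall>B. ifs_invariant X S W B \<longrightarrow> B = A)"

text \<open>
  A partition \<open>x 0 < \<dots> < x N\<close> is a function on \<open>nat\<close> of which only the values at \<open>0, \<dots>, N\<close>
  matter; likewise only \<open>\<alpha> 1, \<dots>, \<alpha> N\<close> and the values of \<open>f\<close>, \<open>b\<close> on \<open>{x 0..x N}\<close> matter below.
\<close>

definition frac_a :: "nat \<Rightarrow> (nat \<Rightarrow> real) \<Rightarrow> nat \<Rightarrow> real" where
  "frac_a N x i = (x i - x (i - 1)) / (x N - x 0)"

definition frac_e :: "nat \<Rightarrow> (nat \<Rightarrow> real) \<Rightarrow> nat \<Rightarrow> real" where
  "frac_e N x i = (x N * x (i - 1) - x 0 * x i) / (x N - x 0)"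

definition frac_L :: "nat \<Rightarrow> (nat \<Rightarrow> real) \<Rightarrow> nat \<Rightarrow> real \<Rightarrow> real" where
  "frac_L N x i t = frac_a N x i * t + frac_e N x i"

definition frac_W :: "nat \<Rightarrow> (nat \<Rightarrow> real) \<Rightarrow> (nat \<Rightarrow> real) \<Rightarrow> (real \<Rightarrow> real) \<Rightarrow> (real \<Rightarrow> real) \<Rightarrow>
    nat \<Rightarrow> real \<times> real \<Rightarrow> real \<times> real" where
  "frac_W N x \<alpha> f b i = (\<lambda>(t, y). (frac_L N x i t, \<alpha> i * y + f (frac_L N x i t) - \<alpha> i * b t))"

definition is_alpha_fractal :: "nat \<Rightarrow> (nat \<Rightarrow> real) \<Rightarrow> (nat \<Rightarrow> real) \<Rightarrow> (real \<Rightarrow> real) \<Rightarrow>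
    (real \<Rightarrow> real) \<Rightarrow> (real \<Rightarrow> real) \<Rightarrow> bool" where
  "is_alpha_fractal N x \<alpha> f b g \<longleftrightarrow>
     continuous_on {x 0..x N} g \<and>
     ifs_attractor ({x 0..x N} \<times> UNIV) {1..N} (frac_W N x \<alpha> f b) ((\<lambda>t. (t, g t)) ` {x 0..x N})"

text \<open>Functions on an interval are total functions, made unique here by extensionality outside it.\<close>

definition alpha_fractal :: "nat \<Rightarrow> (nat \<Rightarrow> real) \<Rightarrow> (nat \<Rightarrow> real) \<Rightarrow> (real \<Rightarrow> real) \<Rightarrow>
    (real \<Rightarrow> real) \<Rightarrow> real \<Rightarrow> real" where
  "alpha_fractal N x \<alpha> f b =
     (THE g. g \<in> extensional {x 0..x N} \<and> is_alpha_fractal N x \<alpha> f b g)"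

definition flip_fun :: "(real \<Rightarrow> real) \<Rightarrow> real \<Rightarrow> real" where
  "flip_fun f = (\<lambda>t. f (- t))"

definition flip_nodes :: "nat \<Rightarrow> (nat \<Rightarrow> real) \<Rightarrow> nat \<Rightarrow> real" where
  "flip_nodes N x = (\<lambda>i. - x (N - i))"

definition flip_scale :: "nat \<Rightarrow> (nat \<Rightarrow> real) \<Rightarrow> nat \<Rightarrow> real" where
  "flip_scale N \<alpha> = (\<lambda>i. \<alpha> (N + 1 - i))"

end

(*
  The functional equation is invariant under the reflection t |-> -t, which exchanges the maps
  L_i and L_(N+1-i). It remains to see that the equation characterizes the fractal function.
  A continuous solution exists by Banach's fixed point theorem, and the graph of any continuous
  solution is the unique nonempty compact invariant set of the iterated function system. Existence
  is needed since the fractal function is a definite description, which has no known value when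
  nothing satisfies it.
*)
theory Submission
  imports Defs
begin

section \<open>Affine maps onto the subintervals of a partition\<close>

locale node_partition =
  fixes N :: nat and x :: "nat \<Rightarrow> real"
  assumes N_ge_2: "N \<ge> 2" and nodes_strict_mono: "strict_mono_on {0..N} x"
begin

abbreviation "a \<equiv> frac_a N x"
abbreviation "L \<equiv> frac_L N x"

definition L_inv :: "nat \<Rightarrow> real \<Rightarrow> real" where
  "L_inv i s = (s - frac_e N x i) / a i"

lemma nodes_less: "i < j \<Longrightarrow> j \<le> N \<Longrightarrow> x i < x j"
  using nodes_strict_mono by (auto simp: strict_mono_on_def)

lemma nodes_le: "i \<le> j \<Longrightarrow> j \<le> N \<Longrightarrow> x i \<le> x j"
  using nodes_less[of i j] by (cases "i = j") auto

lemma endpoints_less: "x 0 < x N"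
  using N_ge_2 by (intro nodes_less) auto

lemma a_pos: "i \<in> {1..N} \<Longrightarrow> 0 < a i"
  using nodes_less[of "i - 1" i] endpoints_less by (auto simp: frac_a_def)

text \<open>Strictness rests on \<open>N_ge_2\<close>: another subinterval of positive length
  remains. For \<open>N = 1\<close> the only map would be the identity.\<close>

lemma a_less_1:
  assumes "i \<in> {1..N}"
  shows "a i < 1"
proof -
  have "x i - x (i - 1) < x N - x 0"
  proof (cases "i = N")
    case True
    then show ?thesis using N_ge_2 nodes_less[of 0 "N - 1"] by auto
  next
    case False
    then have "x i < x N" using assms by (intro nodes_less) auto
    moreover have "x 0 \<le> x (i - 1)" using assms by (intro nodes_le) auto
    ultimately show ?thesis by simp
  qed
  then show ?thesis using endpoints_less by (simp add: frac_a_def)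
qed

lemma L_diff: "L i s - L i t = a i * (s - t)"
  by (simp add: frac_L_def algebra_simps)

lemma L_eq: "L i t = ((x i - x (i - 1)) * t + (x N * x (i - 1) - x 0 * x i)) / (x N - x 0)"
  by (simp add: frac_L_def frac_a_def frac_e_def add_divide_distrib)

lemma L_left: "L i (x 0) = x (i - 1)"
proof -
  have "L i (x 0) = ((x N - x 0) * x (i - 1)) / (x N - x 0)"
    unfolding L_eq by (simp add: algebra_simps)
  then show ?thesis using endpoints_less by simp
qed

lemma L_right: "L i (x N) = x i"
proof -
  have "L i (x N) = ((x N - x 0) * x i) / (x N - x 0)"
    unfolding L_eq by (simp add: algebra_simps)
  then show ?thesis using endpoints_less by simp
qed

lemma L_le_iff: "i \<in> {1..N} \<Longrightarrow> L i s \<le> L i t \<longleftrightarrow> s \<le> t"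
  using a_pos[of i] by (simp add: frac_L_def)

lemma L_less_iff: "i \<in> {1..N} \<Longrightarrow> L i s < L i t \<longleftrightarrow> s < t"
  using a_pos[of i] by (simp add: frac_L_def)

lemma L_L_inv: "i \<in> {1..N} \<Longrightarrow> L i (L_inv i s) = s"
  using a_pos[of i] by (simp add: frac_L_def L_inv_def)

lemma L_inv_L: "i \<in> {1..N} \<Longrightarrow> L_inv i (L i s) = s"
  using a_pos[of i] by (simp add: frac_L_def L_inv_def)

lemma L_mem_iff: "i \<in> {1..N} \<Longrightarrow> L i s \<in> {x (i - 1)..x i} \<longleftrightarrow> s \<in> {x 0..x N}"
  using L_le_iff[of i "x 0" s] L_le_iff[of i s "x N"] by (simp add: L_left L_right)

lemma L_mem_interior_iff: "i \<in> {1..N} \<Longrightarrow> L i s \<in> {x (i - 1)<..<x i} \<longleftrightarrow> s \<in> {x 0<..<x N}"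
  using L_less_iff[of i "x 0" s] L_less_iff[of i s "x N"] by (simp add: L_left L_right)

lemma L_mem:
  assumes "i \<in> {1..N}" "s \<in> {x 0..x N}"
  shows "L i s \<in> {x 0..x N}"
proof -
  have "x 0 \<le> x (i - 1)" "x i \<le> x N" using assms by (auto intro!: nodes_le)
  then show ?thesis using L_mem_iff[of i s] assms by auto
qed

lemma L_inv_interior:
  assumes "i \<in> {1..N}" "L_inv i s \<in> {x 0<..<x N}"
  shows "s \<in> {x (i - 1)<..<x i}" "s \<in> {x 0<..<x N}"
proof -
  show "s \<in> {x (i - 1)<..<x i}"
    using L_mem_interior_iff[of i "L_inv i s"] L_L_inv[of i s] assms by simp
  moreover have "x 0 \<le> x (i - 1)" "x i \<le> x N" using assms by (auto intro!: nodes_le)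
  ultimately show "s \<in> {x 0<..<x N}" by auto
qed

text \<open>Distinct subintervals share at most a node, and \<open>L_inv j\<close> sends the nodes
  \<open>x (j - 1)\<close> and \<open>x j\<close> to endpoints; hence the open interval
  here.\<close>

lemma L_inv_L_other:
  assumes "i \<in> {1..N}" "j \<in> {1..N}" "j \<noteq> i" "s \<in> {x 0..x N}"
  shows "L_inv j (L i s) \<notin> {x 0<..<x N}"
proof
  assume "L_inv j (L i s) \<in> {x 0<..<x N}"
  then have "L i s \<in> {x (j - 1)<..<x j}" using L_inv_interior assms by blast
  moreover have "L i s \<in> {x (i - 1)..x i}" using L_mem_iff assms by blast
  moreover have "x i \<le> x (j - 1)" if "i < j" using that assms by (intro nodes_le) auto
  moreover have "x j \<le> x (i - 1)" if "j < i" using that assms by (intro nodes_le) auto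
  ultimately show False using \<open>j \<noteq> i\<close> by (cases "i < j") auto
qed

lemma L_cover:
  assumes "t \<in> {x 0..x N}"
  obtains i s where "i \<in> {1..N}" "s \<in> {x 0..x N}" "t = L i s"
proof -
  \<comment> \<open>Generalised from \<open>N\<close> to \<open>n\<close> for the induction; each
    step adds one subinterval on the right.\<close>
  have "\<exists>i\<in>{1..n}. t \<in> {x (i - 1)..x i}" if "t \<in> {x 0..x n}" "1 \<le> n" for n
    using that(2,1)
  proof (induction n rule: dec_induct)
    case base
    then show ?case by auto
  next
    case (step n)
    show ?case
    proof (cases "t \<le> x n")
      case True
      then have "\<exists>i\<in>{1..n}. t \<in> {x (i - 1)..x i}" using step by auto
      then show ?thesis by force
    next
      case False
      then show ?thesis using step.prems by (intro bexI[of _ "Suc n"]) auto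
    qed
  qed
  from this[OF assms] N_ge_2 obtain i where i: "i \<in> {1..N}" "t \<in> {x (i - 1)..x i}" by auto
  then show thesis
    using that[of i "L_inv i t"] L_mem_iff[of i "L_inv i t"] by (simp add: L_L_inv)
qed

section \<open>The functional equation and the attractor\<close>

text \<open>Points of a subinterval are written as \<open>L i t\<close>, which avoids inverse maps.
  An interior node is reached twice, as \<open>L i (x N)\<close> and as
  \<open>L (i + 1) (x 0)\<close>.\<close>

definition fractal_equation ::
  "(nat \<Rightarrow> real) \<Rightarrow> (real \<Rightarrow> real) \<Rightarrow> (real \<Rightarrow> real) \<Rightarrow> (real \<Rightarrow> real) \<Rightarrow> bool" where
  "fractal_equation \<alpha> f b g \<longleftrightarrow>
     (\<forall>i\<in>{1..N}. \<forall>t\<in>{x 0..x N}. g (L i t) = f (L i t) + \<alpha> i * (g t - b t))"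

text \<open>
  For an invariant set \<open>B\<close>, contraction in the second coordinate forces \<open>B\<close> into the graph
  of \<open>g\<close>, and contraction in the first makes its projection all of \<open>{x 0..x N}\<close>. In both
  cases one looks at a point of maximal distance, which exists by compactness.
\<close>

lemma ifs_invariant_subset_graph:
  assumes \<alpha>: "\<forall>i\<in>{1..N}. \<bar>\<alpha> i\<bar> < 1"
    and g: "continuous_on {x 0..x N} g" "fractal_equation \<alpha> f b g"
    and B: "ifs_invariant ({x 0..x N} \<times> UNIV) {1..N} (frac_W N x \<alpha> f b) B"
    and p: "p \<in> B"
  shows "snd p = g (fst p)"
proof -
  let ?d = "\<lambda>p. \<bar>snd p - g (fst p)\<bar>"
  have B': "B \<subseteq> {x 0..x N} \<times> UNIV" "B \<noteq> {}" "compact B"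
      "B = (\<Union>i\<in>{1..N}. frac_W N x \<alpha> f b i ` B)"
    using B by (auto simp: ifs_invariant_def)
  have "continuous_on B ?d"
    using B'(1) by (intro continuous_intros continuous_on_compose2[OF g(1)]) auto
  from continuous_attains_sup[OF B'(3,2) this]
  obtain q where q: "q \<in> B" "\<And>r. r \<in> B \<Longrightarrow> ?d r \<le> ?d q" by blast
  from q(1) obtain i r where i: "i \<in> {1..N}" and r: "r \<in> B" "q = frac_W N x \<alpha> f b i r"
    using B'(4) by blast
  have "fst r \<in> {x 0..x N}" using r(1) B'(1) by auto
  \<comment> \<open>The equation at \<open>fst r\<close> cancels all but the vertical deviation,
    scaled by \<open>\<alpha> i\<close>. As \<open>q\<close> is the image of \<open>r\<close>, the
    maximum is at most \<open>\<bar>\<alpha> i\<bar>\<close> times itself.\<close>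
  then have "snd q - g (fst q) = \<alpha> i * (snd r - g (fst r))"
    using g(2) i by (simp add: r(2) frac_W_def fractal_equation_def case_prod_unfold algebra_simps)
  then have "?d q = \<bar>\<alpha> i\<bar> * ?d r" by (simp add: abs_mult)
  also have "\<dots> \<le> \<bar>\<alpha> i\<bar> * ?d q" by (intro mult_left_mono q r) simp
  finally have "(1 - \<bar>\<alpha> i\<bar>) * ?d q \<le> 0" by (simp add: algebra_simps)
  moreover have "0 < 1 - \<bar>\<alpha> i\<bar>" using \<alpha> i by simp
  ultimately have "?d q \<le> 0" by (simp add: mult_le_0_iff)
  with q(2)[OF p] show ?thesis by simp
qed

lemma L_invariant_compact_eq:
  assumes P: "P \<subseteq> {x 0..x N}" "P \<noteq> {}" "compact P"
    and inv: "\<And>i p. i \<in> {1..N} \<Longrightarrow> p \<in> P \<Longrightarrow> L i p \<in> P"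
  shows "P = {x 0..x N}"
proof -
  have "continuous_on {x 0..x N} (\<lambda>t. infdist t P)" by (intro continuous_intros)
  from continuous_attains_sup[OF _ _ this] endpoints_less
  obtain t where t: "t \<in> {x 0..x N}" "\<And>s. s \<in> {x 0..x N} \<Longrightarrow> infdist s P \<le> infdist t P"
    by (auto simp del: atLeastAtMost_iff)
  from L_cover[OF t(1)] obtain i s where i: "i \<in> {1..N}" "s \<in> {x 0..x N}" "t = L i s" .
  obtain p where p: "p \<in> P" "infdist s P = dist s p"
    using infdist_attains_inf[OF compact_imp_closed[OF P(3)] P(2)] by blast
  \<comment> \<open>Invariance puts \<open>L i p\<close> into \<open>P\<close>, so the maximal
    distance is at most \<open>a i\<close> times itself.\<close>
  have "infdist t P \<le> dist t (L i p)" by (intro infdist_le inv i p)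
  also have "\<dots> = a i * infdist s P"
    using a_pos[OF i(1)] by (simp add: p(2) i(3) dist_real_def L_diff abs_mult)
  also have "\<dots> \<le> a i * infdist t P"
    using a_pos[OF i(1)] t(2)[OF i(2)] by (intro mult_left_mono) auto
  finally have "(1 - a i) * infdist t P \<le> 0" by (simp add: algebra_simps)
  then have "infdist t P \<le> 0" using a_less_1[OF i(1)] by (simp add: mult_le_0_iff)
  then have "infdist s P = 0" if "s \<in> {x 0..x N}" for s
    using t(2)[OF that] infdist_nonneg[of s P] by linarith
  then have "{x 0..x N} \<subseteq> P"
    using in_closed_iff_infdist_zero[OF compact_imp_closed[OF P(3)] P(2)] by blast
  with P(1) show ?thesis by blast
qed

text \<open>By the equation, \<open>frac_W\<close> sends the graph point over \<open>t\<close> to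
  the one over \<open>L i t\<close>, and the subintervals cover, so the graph is invariant. Any
  invariant set lies in the graph and projects onto the whole interval, so it is the graph.\<close>

lemma is_alpha_fractalI:
  assumes \<alpha>: "\<forall>i\<in>{1..N}. \<bar>\<alpha> i\<bar> < 1"
    and g: "continuous_on {x 0..x N} g" "fractal_equation \<alpha> f b g"
  shows "is_alpha_fractal N x \<alpha> f b g"
proof -
  let ?W = "frac_W N x \<alpha> f b" and ?I = "{x 0..x N}"
  let ?G = "(\<lambda>t. (t, g t)) ` ?I"
  have W: "?W i (t, g t) = (L i t, g (L i t))" if "i \<in> {1..N}" "t \<in> ?I" for i t
    using g(2) that by (simp add: frac_W_def fractal_equation_def algebra_simps)
  have "?G = (\<Union>i\<in>{1..N}. ?W i ` ?G)"
  proof (intro equalityI subsetI)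
    fix p assume "p \<in> ?G"
    then obtain t where t: "t \<in> ?I" "p = (t, g t)" by blast
    from L_cover[OF t(1)] obtain i s where i: "i \<in> {1..N}" "s \<in> ?I" "t = L i s" .
    then have "p = ?W i (s, g s)" using t(2) W by simp
    with i show "p \<in> (\<Union>i\<in>{1..N}. ?W i ` ?G)" by blast
  next
    fix p assume "p \<in> (\<Union>i\<in>{1..N}. ?W i ` ?G)"
    then obtain i s where i: "i \<in> {1..N}" "s \<in> ?I" "p = ?W i (s, g s)" by blast
    then have "p = (L i s, g (L i s))" using W by simp
    with L_mem[OF i(1,2)] show "p \<in> ?G" by blast
  qed
  moreover have "compact ?G"
    by (intro compact_continuous_image continuous_on_Pair continuous_on_id g) simp
  ultimately have G: "ifs_invariant (?I \<times> UNIV) {1..N} ?W ?G"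
    using endpoints_less unfolding ifs_invariant_def by auto
  have "B = ?G" if B: "ifs_invariant (?I \<times> UNIV) {1..N} ?W B" for B
  proof -
    have graph: "p = (fst p, g (fst p))" if "p \<in> B" for p
      using ifs_invariant_subset_graph[OF \<alpha> g B that] by (metis prod.collapse)
    have B': "B \<subseteq> ?I \<times> UNIV" "B \<noteq> {}" "compact B" "B = (\<Union>i\<in>{1..N}. ?W i ` B)"
      using B by (auto simp: ifs_invariant_def)
    have "fst ` B = ?I"
    proof (rule L_invariant_compact_eq)
      show "fst ` B \<subseteq> ?I" "fst ` B \<noteq> {}" using B' by auto
      show "compact (fst ` B)" by (intro compact_continuous_image continuous_intros B')
      fix i p assume i: "i \<in> {1..N}" and "p \<in> fst ` B"
      then obtain q where "q \<in> B" "p = fst q" by blast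
      then have "?W i q \<in> B" "L i p = fst (?W i q)"
        using B'(4) i by (blast, simp add: frac_W_def case_prod_unfold)
      then show "L i p \<in> fst ` B" by blast
    qed
    \<comment> \<open>Rebuilding a graph point from its first coordinate changes nothing, so the
      full projection forces the full graph.\<close>
    moreover have "(\<lambda>t. (t, g t)) ` fst ` B = (\<lambda>p. p) ` B"
      unfolding image_image by (intro image_cong refl graph[symmetric])
    ultimately show ?thesis by simp
  qed
  with G g(1) show ?thesis unfolding is_alpha_fractal_def ifs_attractor_def by blast
qed

text \<open>Uniqueness of the attractor gives two candidates the same graph; extensionality settles
  the values outside the interval.\<close>

lemma alpha_fractal_eq:
  assumes g: "is_alpha_fractal N x \<alpha> f b g" and t: "t \<in> {x 0..x N}"
  shows "alpha_fractal N x \<alpha> f b t = g t"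
proof -
  let ?I = "{x 0..x N}"
  have "alpha_fractal N x \<alpha> f b = restrict g ?I"
    unfolding alpha_fractal_def
  proof (rule the_equality, rule conjI)
    have "(\<lambda>t. (t, restrict g ?I t)) ` ?I = (\<lambda>t. (t, g t)) ` ?I"
      by (intro image_cong) auto
    moreover have "continuous_on ?I (restrict g ?I) \<longleftrightarrow> continuous_on ?I g"
      by (intro continuous_on_cong) auto
    ultimately show "is_alpha_fractal N x \<alpha> f b (restrict g ?I)"
      using g by (simp add: is_alpha_fractal_def del: restrict_apply)
  next
    fix h assume h: "h \<in> extensional ?I \<and> is_alpha_fractal N x \<alpha> f b h"
    then have "(\<lambda>t. (t, h t)) ` ?I = (\<lambda>t. (t, g t)) ` ?I"
      using g by (auto simp: is_alpha_fractal_def ifs_attractor_def)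
    then have "h t = g t" if "t \<in> ?I" for t using that by (auto simp: set_eq_iff image_iff)
    then show "h = restrict g ?I"
      using h by (intro extensionalityI[of _ ?I]) auto
  qed simp
  then show ?thesis using t by simp
qed

section \<open>Existence of a continuous solution\<close>

text \<open>Only \<open>j = i\<close> contributes, since the other preimages fall where
  \<open>d\<close> vanishes.\<close>

lemma fractal_equation_sum_L:
  fixes \<alpha> :: "nat \<Rightarrow> real" and d :: "real \<Rightarrow> real"
  assumes d: "\<And>s. s \<notin> {x 0<..<x N} \<Longrightarrow> d s = 0" and i: "i \<in> {1..N}" and t: "t \<in> {x 0..x N}"
  shows "(\<Sum>j\<in>{1..N}. \<alpha> j * d (L_inv j (L i t))) = \<alpha> i * d t"
proof -
  have "\<alpha> j * d (L_inv j (L i t)) = (if j = i then \<alpha> i * d t else 0)" if "j \<in> {1..N}" for j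
  proof (cases "j = i")
    case True
    then show ?thesis using i by (simp add: L_inv_L)
  next
    case False
    then show ?thesis using d[OF L_inv_L_other[OF i that False t]] by simp
  qed
  then have "(\<Sum>j\<in>{1..N}. \<alpha> j * d (L_inv j (L i t))) = (\<Sum>j\<in>{1..N}. if j = i then \<alpha> i * d t else 0)"
    by (intro sum.cong refl)
  then show ?thesis using i by simp
qed

text \<open>Lets the fixed point operator preserve vanishing off the open interval.\<close>

lemma fractal_equation_sum_outside:
  fixes \<alpha> :: "nat \<Rightarrow> real" and d :: "real \<Rightarrow> real"
  assumes d: "\<And>s. s \<notin> {x 0<..<x N} \<Longrightarrow> d s = 0" and s: "s \<notin> {x 0<..<x N}"
  shows "(\<Sum>j\<in>{1..N}. \<alpha> j * d (L_inv j s)) = 0"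
proof (intro sum.neutral ballI)
  fix j assume "j \<in> {1..N}"
  then have "L_inv j s \<notin> {x 0<..<x N}" using s L_inv_interior(2) by blast
  then show "\<alpha> j * d (L_inv j s) = 0" using d by simp
qed

text \<open>
  The difference \<open>h = g - b\<close> vanishes at both endpoints, so it extends by zero to a continuous
  function on the whole line, and the piecewise equation for \<open>g\<close> becomes the single equation
  \<open>h = (f - b) + (\<Sum>j. \<alpha> j * (h \<circ> L_inv j))\<close>, whose summands have disjoint supports.
\<close>

lemma fractal_equation_solvable:
  assumes \<alpha>: "\<forall>i\<in>{1..N}. \<bar>\<alpha> i\<bar> < 1"
    and f: "continuous_on {x 0..x N} f" and b: "continuous_on {x 0..x N} b"
    and ends: "b (x 0) = f (x 0)" "b (x N) = f (x N)"
  obtains g where "continuous_on {x 0..x N} g" "fractal_equation \<alpha> f b g"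
proof -
  let ?I = "{x 0..x N}" and ?J = "{x 0<..<x N}"
  \<comment> \<open>Clamping the argument extends \<open>f - b\<close> by its endpoint values, which
    are zero by \<open>ends\<close>.\<close>
  define F where "F = (\<lambda>s. f (max (x 0) (min (x N) s)) - b (max (x 0) (min (x N) s)))"
  define T where "T = (\<lambda>(h :: real \<Rightarrow>\<^sub>C real) s. F s + (\<Sum>j\<in>{1..N}. \<alpha> j * h (L_inv j s)))"
  \<comment> \<open>A \<open>PiC\<close> set of bounded continuous functions with closed fibres is
    closed, hence complete.\<close>
  define S where "S = PiC (- ?J) (\<lambda>_. {0 :: real})"
  define c where "c = Max ((\<lambda>i. \<bar>\<alpha> i\<bar>) ` {1..N})"
  have S_iff: "h \<in> S \<longleftrightarrow> (\<forall>s. s \<notin> ?J \<longrightarrow> apply_bcontfun h s = 0)" for h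
    by (auto simp: S_def mem_PiC_iff Pi_iff)
  have F_on: "F s = f s - b s" if "s \<in> ?I" for s using that by (simp add: F_def)
  have F_off: "F s = 0" if "s \<notin> ?J" for s
    using that ends endpoints_less by (auto simp: F_def max_def min_def)
  have cont_fb: "continuous_on ?I (\<lambda>t. f t - b t)" by (intro continuous_intros f b)
  have F_cont: "continuous_on UNIV F"
    unfolding F_def
    by (rule continuous_on_compose2[OF cont_fb]) (use endpoints_less in \<open>auto intro!: continuous_intros\<close>)
  have F_bcont: "F \<in> bcontfun"
  proof -
    have "bounded ((\<lambda>t. f t - b t) ` ?I)"
      by (intro compact_imp_bounded compact_continuous_image cont_fb) simp
    then have "bounded (range F)"
      by (rule bounded_subset) (use endpoints_less in \<open>auto simp: F_def\<close>)
    with F_cont show ?thesis by (simp add: bcontfun_def)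
  qed
  have "(\<lambda>s. \<Sum>j\<in>A. \<alpha> j * apply_bcontfun h (L_inv j s)) \<in> bcontfun"
    if "A \<subseteq> {1..N}" for h A
  proof (rule bcontfun_normI)
    show "continuous_on UNIV (\<lambda>s. \<Sum>j\<in>A. \<alpha> j * apply_bcontfun h (L_inv j s))"
      using a_pos that unfolding L_inv_def
      by (intro continuous_intros continuous_on_compose2[OF continuous_on_apply_bcontfun[of UNIV]])
        force+
    show "norm (\<Sum>j\<in>A. \<alpha> j * apply_bcontfun h (L_inv j s)) \<le> (\<Sum>j\<in>A. \<bar>\<alpha> j\<bar> * norm h)" for s
      using norm_bounded[of h]
      by (intro order.trans[OF norm_sum] sum_mono) (auto simp: abs_mult intro!: mult_left_mono)
  qed
  then have T_bcont: "T h \<in> bcontfun" for h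
    unfolding T_def by (intro plus_cont F_bcont) auto
  then have T_apply: "apply_bcontfun (Bcontfun (T h)) = T h" for h
    by (rule Bcontfun_inverse)
  have c: "0 \<le> c" "c < 1" "\<And>i. i \<in> {1..N} \<Longrightarrow> \<bar>\<alpha> i\<bar> \<le> c"
  proof -
    show le: "\<bar>\<alpha> i\<bar> \<le> c" if "i \<in> {1..N}" for i using that by (simp add: c_def)
    show "0 \<le> c" using le[of 1] N_ge_2 by auto
    show "c < 1" using \<alpha> N_ge_2 by (simp add: c_def)
  qed
  have "\<exists>!h. h \<in> S \<and> Bcontfun (T h) = h"
  proof (rule Banach_fix)
    show "complete S" by (simp add: complete_eq_closed S_def closed_PiC)
    have "0 \<in> S" by (simp add: S_iff)
    then show "S \<noteq> {}" by blast
    show "(\<lambda>h. Bcontfun (T h)) ` S \<subseteq> S"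
    proof (rule image_subsetI)
      fix h assume "h \<in> S"
      then have "T h s = 0" if "s \<notin> ?J" for s
        unfolding T_def F_off[OF that] add_0_left
        by (intro fractal_equation_sum_outside that) (use S_iff in blast)
      then show "Bcontfun (T h) \<in> S" unfolding S_iff T_apply by blast
    qed
    show "dist (Bcontfun (T h)) (Bcontfun (T k)) \<le> c * dist h k" if "h \<in> S" "k \<in> S" for h k
    proof (rule dist_bound)
      fix s
      let ?d = "\<lambda>s. apply_bcontfun h s - apply_bcontfun k s"
      have d: "?d s = 0" if "s \<notin> ?J" for s using \<open>h \<in> S\<close> \<open>k \<in> S\<close> that by (simp add: S_iff)
      have diff: "T h s - T k s = (\<Sum>j\<in>{1..N}. \<alpha> j * ?d (L_inv j s))"
        by (simp add: T_def sum_subtractf right_diff_distrib)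
      have "\<bar>T h s - T k s\<bar> \<le> c * dist h k"
      \<comment> \<open>Inside the interval a single summand survives, so the Lipschitz constant is
        the maximum \<open>c\<close> and not a sum of scales; outside, all summands vanish.\<close>
      proof (cases "s \<in> ?I")
        case True
        from L_cover[OF this] obtain i t where i: "i \<in> {1..N}" "t \<in> ?I" "s = L i t" .
        have "T h s - T k s = \<alpha> i * ?d t"
          unfolding diff unfolding i(3) by (rule fractal_equation_sum_L[OF d i(1,2)])
        then have "\<bar>T h s - T k s\<bar> = \<bar>\<alpha> i\<bar> * dist (apply_bcontfun h t) (apply_bcontfun k t)"
          by (simp add: abs_mult dist_real_def)
        also have "\<dots> \<le> c * dist h k"
          using c(1) by (intro mult_mono c(3) i dist_bounded) auto
        finally show ?thesis .
      next
        case False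
        then have "T h s - T k s = 0"
          unfolding diff using d by (intro fractal_equation_sum_outside) auto
        then show ?thesis using c(1) by simp
      qed
      then show "dist (apply_bcontfun (Bcontfun (T h)) s) (apply_bcontfun (Bcontfun (T k)) s)
          \<le> c * dist h k"
        by (simp add: T_apply dist_real_def)
    qed
  qed (use c in auto)
  then obtain h where h: "h \<in> S" "Bcontfun (T h) = h" by blast
  have eq: "apply_bcontfun h s = T h s" for s using h(2) T_apply by metis
  show thesis
  proof (rule that)
    show "continuous_on ?I (\<lambda>t. apply_bcontfun h t + b t)" by (intro continuous_intros b) simp
    show "fractal_equation \<alpha> f b (\<lambda>t. apply_bcontfun h t + b t)"
      unfolding fractal_equation_def
    proof (intro ballI)
      fix i t assume i: "i \<in> {1..N}" and t: "t \<in> ?I"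
      \<comment> \<open>At \<open>L i t\<close> the fixed point equation reduces to one summand;
        adding \<open>b\<close> back yields the equation for \<open>h + b\<close>.\<close>
      have "apply_bcontfun h (L i t) = F (L i t) + \<alpha> i * apply_bcontfun h t"
        using h(1) i t fractal_equation_sum_L[of "apply_bcontfun h" i t \<alpha>]
        by (subst eq) (simp add: T_def S_iff)
      then show "apply_bcontfun h (L i t) + b (L i t)
          = f (L i t) + \<alpha> i * (apply_bcontfun h t + b t - b t)"
        using F_on[OF L_mem[OF i t]] by simp
    qed
  qed
qed

section \<open>Reflection of the partition\<close>

lemma flip_nodes_partition: "node_partition N (flip_nodes N x)"
  using N_ge_2
  by unfold_locales (auto simp: flip_nodes_def strict_mono_on_def intro!: nodes_less)

lemma flip_endpoints: "flip_nodes N x 0 = - x N" "flip_nodes N x N = - x 0"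
  by (simp_all add: flip_nodes_def)

text \<open>The \<open>i\<close>-th flipped subinterval runs from \<open>- x (N + 1 - i)\<close> to
  \<open>- x (N - i)\<close>, the mirror image of subinterval \<open>N + 1 - i\<close>. The range of
  \<open>i\<close> keeps the natural-number subtractions exact.\<close>

lemma frac_L_flip:
  assumes "i \<in> {1..N}"
  shows "frac_L N (flip_nodes N x) i t = - L (N + 1 - i) (- t)"
proof -
  have "N - (i - 1) = N + 1 - i" "N + 1 - i - 1 = N - i" using assms by auto
  then show ?thesis
    unfolding L_eq node_partition.L_eq[OF flip_nodes_partition] minus_divide_left
    by (simp add: flip_nodes_def algebra_simps)
qed

end

theorem mainTheorem3:
  fixes N :: nat and x \<alpha> :: "nat \<Rightarrow> real" and f b :: "real \<Rightarrow> real"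
  assumes "N \<ge> 2"
    and "strict_mono_on {0..N} x"
    and "\<forall>i\<in>{1..N}. \<bar>\<alpha> i\<bar> < 1"
    and "continuous_on {x 0..x N} f"
    and "continuous_on {x 0..x N} b"
    and "b (x 0) = f (x 0)"
    and "b (x N) = f (x N)"
  shows "\<forall>t\<in>{x 0..x N}.
    alpha_fractal N (flip_nodes N x) (flip_scale N \<alpha>) (flip_fun f) (flip_fun b) (- t)
      = alpha_fractal N x \<alpha> f b t"
proof
  fix t assume t: "t \<in> {x 0..x N}"
  interpret P: node_partition N x using assms by unfold_locales
  interpret Q: node_partition N "flip_nodes N x" by (rule P.flip_nodes_partition)
  \<comment> \<open>One solution serves both sides: \<open>g\<close> for the original data and
    \<open>flip_fun g\<close> for the flipped data.\<close>
  obtain g where g: "continuous_on {x 0..x N} g" "P.fractal_equation \<alpha> f b g"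
    using P.fractal_equation_solvable assms by blast
  have "Q.fractal_equation (flip_scale N \<alpha>) (flip_fun f) (flip_fun b) (flip_fun g)"
    unfolding Q.fractal_equation_def P.flip_endpoints
  proof (intro ballI)
    fix i s assume i: "i \<in> {1..N}" and "s \<in> {- x N..- x 0}"
    \<comment> \<open>The flipped equation at \<open>i\<close> and \<open>s\<close> is the original
      one at this index and point.\<close>
    then have "N + 1 - i \<in> {1..N}" "- s \<in> {x 0..x N}" by auto
    then show "flip_fun g (Q.L i s)
        = flip_fun f (Q.L i s) + flip_scale N \<alpha> i * (flip_fun g s - flip_fun b s)"
      using g(2) by (simp only: P.fractal_equation_def P.frac_L_flip[OF i] flip_fun_def
          flip_scale_def minus_minus)
  qed
  moreover have "continuous_on {- x N..- x 0} (flip_fun g)"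
    unfolding flip_fun_def by (rule continuous_on_compose2[OF g(1)]) (auto intro!: continuous_intros)
  moreover have "\<forall>i\<in>{1..N}. \<bar>flip_scale N \<alpha> i\<bar> < 1"
    unfolding flip_scale_def by (intro ballI assms(3)[rule_format]) auto
  ultimately have "is_alpha_fractal N (flip_nodes N x) (flip_scale N \<alpha>) (flip_fun f) (flip_fun b)
      (flip_fun g)"
    by (intro Q.is_alpha_fractalI) (simp_all add: P.flip_endpoints)
  then have "alpha_fractal N (flip_nodes N x) (flip_scale N \<alpha>) (flip_fun f) (flip_fun b) (- t)
      = flip_fun g (- t)"
    using t by (intro Q.alpha_fractal_eq) (simp_all add: P.flip_endpoints)
  also have "\<dots> = alpha_fractal N x \<alpha> f b t"
    using P.alpha_fractal_eq[OF P.is_alpha_fractalI[OF assms(3) g] t] by (simp add: flip_fun_def)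
  finally show "alpha_fractal N (flip_nodes N x) (flip_scale N \<alpha>) (flip_fun f) (flip_fun b) (- t)
      = alpha_fractal N x \<alpha> f b t" .
qed

end
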